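(* Let $X$ be a nonempty locally compact Hausdorff space and let $(Y,d)$ be a metric space with at least two points. The following assertions are equivalent: (1) $MU(X,Y)$ is compact; (2) $D_2(X,Y)$ (with the subspace topology inherited from $MU(X,Y)$) is compact; (3) $Y$ is compact and $X$ is discrete.
   Context: A map (multifunction) $F\colon X\to Y$ assigns to each $x\in X$ a subset $F(x)\subseteq Y$; for $A\subseteq X$ put $F(A)=\bigcup_{x\in A}F(x)$. Maps are identified with their graphs $\{(x,y): y\in F(x)\}$. $F$ is upper semicontinuous if for every $x\in X$ and every open $V\supseteq F(x)$ there is an open $U\ni x$ with $F(U)\subseteq V$. $F$ is usco if it is upper semicontinuous and every $F(x)$ is a nonempty compact set. $F$ is minimal usco if it is usco and its graph does not properly contain the graph of any other usco map from $X$ to $Y$. $MU(X,Y)$ is the set of all minimal usco maps from $X$ to $Y$. Let $K(Y)$ be the set of nonempty compact subsets of $Y$, and $H_d$ the Hausdorff metric on $K(Y)$. On $K(Y)^X$ the topology $\tau_{uc}$ of uniform convergence on compact sets is induced by the uniformity $\mathcal U_{uc}$ with base consisting of the sets $W[K,\varepsilon]=\{(F,G): H_d(F(x),G(x))<\varepsilon \text{ for every } x\in K\}$, where $K\subseteq X$ is compact and $\varepsilon>0$. $MU(X,Y)\subseteq K(Y)^X$ carries the subspace topology of $\tau_{uc}$. Finally, $D_2(X,Y)=\{F\in MU(X,Y): |F(X)|\le 2\}$. *)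

theory Defs
  imports "HOL-Analysis.Analysis"
begin

definition map_graph :: "('a \<Rightarrow> 'b set) \<Rightarrow> ('a \<times> 'b) set" where
  "map_graph F = {(x, y). y \<in> F x}"

definition map_image :: "('a \<Rightarrow> 'b set) \<Rightarrow> 'a set \<Rightarrow> 'b set" where
  "map_image F A = (\<Union>x\<in>A. F x)"

definition upper_semicontinuous ::
    "('a::topological_space \<Rightarrow> 'b::topological_space set) \<Rightarrow> bool" where
  "upper_semicontinuous F \<longleftrightarrow>
     (\<forall>x V. open V \<and> F x \<subseteq> V \<longrightarrow> (\<exists>U. open U \<and> x \<in> U \<and> map_image F U \<subseteq> V))"

definition usco :: "('a::topological_space \<Rightarrow> 'b::topological_space set) \<Rightarrow> bool" where
  "usco F \<longleftrightarrow> upper_semicontinuous F \<and> (\<forall>x. F x \<noteq> {} \<and> compact (F x))"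

definition minimal_usco :: "('a::topological_space \<Rightarrow> 'b::topological_space set) \<Rightarrow> bool" where
  "minimal_usco F \<longleftrightarrow> usco F \<and> \<not> (\<exists>G. usco G \<and> map_graph G \<subset> map_graph F)"

definition MU :: "('a::topological_space \<Rightarrow> 'b::topological_space set) set" where
  "MU = {F. minimal_usco F}"

text \<open>The finiteness condition is needed because \<open>card\<close> is 0 on infinite sets.\<close>

definition D2 :: "('a::topological_space \<Rightarrow> 'b::topological_space set) set" where
  "D2 = {F \<in> MU. finite (map_image F UNIV) \<and> card (map_image F UNIV) \<le> 2}"

definition nonempty_compacts :: "'b::topological_space set set" where
  "nonempty_compacts = {A. A \<noteq> {} \<and> compact A}"

text \<open>Used only for nonempty compact \<open>A\<close> and \<open>B\<close>, where both suprema range over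
  nonempty bounded sets of reals.\<close>

definition hausdorff_dist :: "'b::metric_space set \<Rightarrow> 'b set \<Rightarrow> real" where
  "hausdorff_dist A B = max (SUP a\<in>A. infdist a B) (SUP b\<in>B. infdist b A)"

definition compact_valued :: "('a \<Rightarrow> 'b::topological_space set) set" where
  "compact_valued = {F. \<forall>x. F x \<in> nonempty_compacts}"

definition uc_entourage ::
    "'a::topological_space set \<Rightarrow> real \<Rightarrow>
     (('a \<Rightarrow> 'b::metric_space set) \<times> ('a \<Rightarrow> 'b set)) set" where
  "uc_entourage K \<epsilon> = {(F, G). F \<in> compact_valued \<and> G \<in> compact_valued \<and>
     (\<forall>x\<in>K. hausdorff_dist (F x) (G x) < \<epsilon>)}"

text \<open>The topology induced by the uniformity with base \<open>uc_entourage K \<epsilon>\<close>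
  (\<open>K\<close> compact, \<open>\<epsilon> > 0\<close>): a set is open iff with each of its points \<open>F\<close> it contains
  the section at \<open>F\<close> of some basic entourage.\<close>

definition uc_topology :: "('a::topological_space \<Rightarrow> 'b::metric_space set) topology" where
  "uc_topology = topology (\<lambda>\<U>. \<U> \<subseteq> compact_valued \<and>
     (\<forall>F\<in>\<U>. \<exists>K \<epsilon>. compact K \<and> 0 < \<epsilon> \<and> uc_entourage K \<epsilon> `` {F} \<subseteq> \<U>))"

lemma uc_entourage_mono:
  "K \<subseteq> K' \<Longrightarrow> \<epsilon>' \<le> \<epsilon> \<Longrightarrow> uc_entourage K' \<epsilon>' \<subseteq> uc_entourage K \<epsilon>"
  by (fastforce simp: uc_entourage_def)

lemma openin_uc_topology:
  "openin uc_topology \<U> \<longleftrightarrow> \<U> \<subseteq> compact_valued \<and>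
     (\<forall>F\<in>\<U>. \<exists>K \<epsilon>. compact K \<and> 0 < \<epsilon> \<and> uc_entourage K \<epsilon> `` {F} \<subseteq> \<U>)"
proof -
  let ?P = "\<lambda>\<U> :: ('a \<Rightarrow> 'b set) set. \<U> \<subseteq> compact_valued \<and>
     (\<forall>F\<in>\<U>. \<exists>K \<epsilon>. compact K \<and> 0 < \<epsilon> \<and> uc_entourage K \<epsilon> `` {F} \<subseteq> \<U>)"
  have int: "?P (S \<inter> T)" if S: "?P S" and T: "?P T" for S T
  proof (intro conjI ballI)
    show "S \<inter> T \<subseteq> compact_valued" using S by blast
    fix F assume F: "F \<in> S \<inter> T"
    from S F obtain K1 e1 where 1: "compact K1" "0 < e1" "uc_entourage K1 e1 `` {F} \<subseteq> S"
      by blast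
    from T F obtain K2 e2 where 2: "compact K2" "0 < e2" "uc_entourage K2 e2 `` {F} \<subseteq> T"
      by blast
    have "uc_entourage (K1 \<union> K2) (min e1 e2) `` {F} \<subseteq> S \<inter> T"
      using uc_entourage_mono[of K1 "K1 \<union> K2" "min e1 e2" e1]
        uc_entourage_mono[of K2 "K1 \<union> K2" "min e1 e2" e2] 1 2 by auto
    then show "\<exists>K \<epsilon>. compact K \<and> 0 < \<epsilon> \<and> uc_entourage K \<epsilon> `` {F} \<subseteq> S \<inter> T"
      using 1 2 compact_Un[of K1 K2] by (intro exI[of _ "K1 \<union> K2"] exI[of _ "min e1 e2"]) simp
  qed
  have un: "?P (\<Union>\<K>)" if K: "\<forall>S\<in>\<K>. ?P S" for \<K>
  proof (intro conjI ballI)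
    show "\<Union>\<K> \<subseteq> compact_valued" using K by (meson Union_least)
    fix F assume "F \<in> \<Union>\<K>"
    then obtain S where S: "S \<in> \<K>" "F \<in> S" by blast
    from bspec[OF K S(1)] S(2) obtain C e
      where C: "compact C" "0 < e" "uc_entourage C e `` {F} \<subseteq> S"
      by blast
    have "uc_entourage C e `` {F} \<subseteq> \<Union>\<K>"
      using C(3) S(1) by (rule subset_trans[OF _ Union_upper])
    with C(1,2) show "\<exists>K \<epsilon>. compact K \<and> 0 < \<epsilon> \<and> uc_entourage K \<epsilon> `` {F} \<subseteq> \<Union>\<K>"
      by blast
  qed
  have "istopology ?P"
    unfolding istopology_def
  proof (rule conjI; intro allI impI)
    show "?P (S \<inter> T)" if "?P S" "?P T" for S T using that by (rule int)
    show "?P (\<Union>\<K>)" if "\<forall>S\<in>\<K>. ?P S" for \<K> using that by (rule un)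
  qed
  then show ?thesis
    unfolding uc_topology_def by (simp only: topology_inverse')
qed

lemma topspace_uc_topology [simp]: "topspace uc_topology = compact_valued"
proof -
  have "uc_entourage {} 1 `` {F} \<subseteq> compact_valued" for F :: "'a \<Rightarrow> 'b set"
    by (auto simp: uc_entourage_def)
  then have "openin uc_topology (compact_valued :: ('a \<Rightarrow> 'b set) set)"
    unfolding openin_uc_topology
    by (intro conjI ballI order_refl exI[of _ "{}"] exI[of _ 1]) simp_all
  then show ?thesis
    using openin_subset[of uc_topology compact_valued] openin_topspace[of uc_topology]
    unfolding openin_uc_topology[of "topspace uc_topology"] by blast
qed

lemma MU_subset_compact_valued: "MU \<subseteq> compact_valued"
  by (auto simp: MU_def minimal_usco_def usco_def compact_valued_def nonempty_compacts_def)

definition MU_space :: "('a::topological_space \<Rightarrow> 'b::metric_space set) topology" where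
  "MU_space = subtopology uc_topology MU"

definition D2_space :: "('a::topological_space \<Rightarrow> 'b::metric_space set) topology" where
  "D2_space = subtopology MU_space D2"

end

theory Submission
  imports Defs
begin

text \<open>
  Two phenomena account for the theorem.

  First, let \<open>y \<noteq> z\<close>. Every open set \<open>W\<close> gives a minimal usco map with values in \<open>{y, z}\<close>: it is
  \<open>{y}\<close> on the interior of the regular closed set \<open>closure W\<close>, \<open>{z}\<close> outside that set, and
  \<open>{y, z}\<close> on its boundary (\<open>minimal_usco_two_valued\<close>). Distinct nonempty subsets of \<open>{y, z}\<close> have Hausdorff distance
  \<open>dist y z\<close>, so two such maps that are uniformly close on a compact set \<open>K\<close> coincide there. If a
  family of maps containing \<open>D2\<close> is compact, then only finitely many traces on \<open>K\<close> occur. But in a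
  Hausdorff space these traces separate the points of \<open>K\<close>, so \<open>K\<close> is finite; with local
  compactness, every point has a finite neighbourhood and the space is discrete
  (\<open>compactin_uc_imp_finite_compacts\<close>). The same family contains all constant maps, which form a
  copy of \<open>Y\<close>, and this forces \<open>Y\<close> to be compact (\<open>compactin_uc_imp_compact_codomain\<close>). The
  argument covers \<open>MU\<close> and \<open>D2\<close> alike.

  Second, over a discrete space the minimal usco maps are exactly the single-valued ones, and
  compact sets are finite, so \<open>MU\<close> carries the topology of the product \<open>Y\<^sup>X\<close>. For compact \<open>Y\<close> this
  is compact by Tychonoff's theorem, and \<open>D2\<close> corresponds to the closed subset of functions that
  do not take three distinct values.
\<close>

section \<open>The Hausdorff distance\<close>

lemma hausdorff_dist_le_iff:
  assumes "A \<in> nonempty_compacts" "B \<in> nonempty_compacts"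
  shows "hausdorff_dist A B \<le> r \<longleftrightarrow> (\<forall>a\<in>A. infdist a B \<le> r) \<and> (\<forall>b\<in>B. infdist b A \<le> r)"
proof -
  have bdd: "bdd_above ((\<lambda>a. infdist a D) ` C)" if "C \<in> nonempty_compacts" for C D :: "'a set"
    using that unfolding nonempty_compacts_def
    by (auto intro!: bounded_imp_bdd_above compact_imp_bounded compact_continuous_image
        continuous_intros)
  have "A \<noteq> {}" "B \<noteq> {}"
    using assms by (auto simp: nonempty_compacts_def)
  then show ?thesis
    unfolding hausdorff_dist_def by (simp add: cSUP_le_iff bdd assms)
qed

lemma hausdorff_dist_commute: "hausdorff_dist A B = hausdorff_dist B A"
  by (simp add: hausdorff_dist_def max.commute)

lemma infdist_le_hausdorff_dist:
  assumes "A \<in> nonempty_compacts" "B \<in> nonempty_compacts" "a \<in> A"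
  shows "infdist a B \<le> hausdorff_dist A B"
  using hausdorff_dist_le_iff[OF assms(1,2), of "hausdorff_dist A B"] assms(3) by simp

lemma hausdorff_dist_triangle:
  assumes "A \<in> nonempty_compacts" "B \<in> nonempty_compacts" "C \<in> nonempty_compacts"
  shows "hausdorff_dist A C \<le> hausdorff_dist A B + hausdorff_dist B C"
proof -
  have one_sided: "infdist a R \<le> hausdorff_dist P Q + hausdorff_dist Q R"
    if ne: "P \<in> nonempty_compacts" "Q \<in> nonempty_compacts" "R \<in> nonempty_compacts" and "a \<in> P"
    for P Q R :: "'a set" and a
  proof -
    have Q: "compact Q" "Q \<noteq> {}"
      using ne(2) by (auto simp: nonempty_compacts_def)
    moreover have "continuous_on Q (dist a)"
      by (intro continuous_intros)
    ultimately obtain b where b: "b \<in> Q" "\<And>c. c \<in> Q \<Longrightarrow> dist a b \<le> dist a c"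
      using continuous_attains_inf[of Q "dist a"] by metis
    then have "dist a b \<le> infdist a Q"
      using Q(2) by (simp add: infdist_notempty cINF_greatest)
    moreover have "infdist a R \<le> infdist b R + dist a b"
      by (rule infdist_triangle)
    ultimately show ?thesis
      using infdist_le_hausdorff_dist[OF ne(2,3) b(1)]
        infdist_le_hausdorff_dist[OF ne(1,2) \<open>a \<in> P\<close>] by linarith
  qed
  show ?thesis
    unfolding hausdorff_dist_le_iff[OF assms(1,3)]
    using one_sided[OF assms] one_sided[OF assms(3,2,1)]
    by (simp add: hausdorff_dist_commute[of B A] hausdorff_dist_commute[of C B] add.commute)
qed

lemma hausdorff_dist_same: "A \<in> nonempty_compacts \<Longrightarrow> hausdorff_dist A A \<le> 0"
  by (simp add: hausdorff_dist_le_iff)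

lemma hausdorff_dist_singletons: "hausdorff_dist {a} {b} = dist a b"
  by (simp add: hausdorff_dist_def dist_commute)

lemma singleton_nonempty_compacts: "{a} \<in> nonempty_compacts"
  by (simp add: nonempty_compacts_def)

lemma dist_le_hausdorff_dist_singleton:
  assumes "B \<in> nonempty_compacts" "b \<in> B"
  shows "dist a b \<le> hausdorff_dist {a} B"
  using infdist_le_hausdorff_dist[OF assms(1) singleton_nonempty_compacts assms(2), of a]
  by (simp add: hausdorff_dist_commute dist_commute)

section \<open>Uniform convergence on compact sets\<close>

lemma compact_valued_nonempty_compacts: "F \<in> compact_valued \<Longrightarrow> F x \<in> nonempty_compacts"
  by (simp add: compact_valued_def)

text \<open>The section of an entourage need not be open, since distances below \<open>\<epsilon>\<close> may have supremum
  \<open>\<epsilon>\<close> on \<open>K\<close>. Asking for a uniform bound \<open>\<delta> < \<epsilon>\<close> leaves room for the triangle inequality.\<close>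

lemma uc_entourage_section_neighbourhood:
  fixes F :: "'a::topological_space \<Rightarrow> 'b::metric_space set"
  assumes F: "F \<in> compact_valued" and K: "compact K" and "0 < \<epsilon>"
  obtains N where "openin uc_topology N" "F \<in> N" "N \<subseteq> uc_entourage K \<epsilon> `` {F}"
proof
  let ?N = "{G \<in> compact_valued. \<exists>\<delta><\<epsilon>. \<forall>x\<in>K. hausdorff_dist (F x) (G x) \<le> \<delta>}"
  show "openin uc_topology ?N"
    unfolding openin_uc_topology
  proof (intro conjI ballI)
    fix G assume "G \<in> ?N"
    then obtain \<delta> where G: "G \<in> compact_valued" "\<delta> < \<epsilon>"
      "\<And>x. x \<in> K \<Longrightarrow> hausdorff_dist (F x) (G x) \<le> \<delta>" by blast
    have "uc_entourage K ((\<epsilon> - \<delta>) / 2) `` {G} \<subseteq> ?N"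
    proof
      fix H assume "H \<in> uc_entourage K ((\<epsilon> - \<delta>) / 2) `` {G}"
      then have H: "H \<in> compact_valued"
        "\<And>x. x \<in> K \<Longrightarrow> hausdorff_dist (G x) (H x) < (\<epsilon> - \<delta>) / 2"
        by (auto simp: uc_entourage_def)
      have "hausdorff_dist (F x) (H x) \<le> \<delta> + (\<epsilon> - \<delta>) / 2" if "x \<in> K" for x
      proof -
        have "hausdorff_dist (F x) (H x) \<le> hausdorff_dist (F x) (G x) + hausdorff_dist (G x) (H x)"
          using F G(1) H(1)
          by (intro hausdorff_dist_triangle compact_valued_nonempty_compacts)
        then show ?thesis
          using G(3)[OF that] H(2)[OF that] by linarith
      qed
      moreover have "\<delta> + (\<epsilon> - \<delta>) / 2 < \<epsilon>"
        using G(2) by (simp add: field_simps)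
      ultimately show "H \<in> ?N" using H(1) by blast
    qed
    then show "\<exists>K \<epsilon>'. compact K \<and> 0 < \<epsilon>' \<and> uc_entourage K \<epsilon>' `` {G} \<subseteq> ?N"
      using K G(2) by (intro exI[of _ K] exI[of _ "(\<epsilon> - \<delta>) / 2"]) simp
  qed blast
  show "F \<in> ?N"
    using F \<open>0 < \<epsilon>\<close> hausdorff_dist_same[OF compact_valued_nonempty_compacts[OF F]]
    by (intro CollectI conjI exI[of _ 0]) simp_all
  show "?N \<subseteq> uc_entourage K \<epsilon> `` {F}"
    using F by (force simp: uc_entourage_def)
qed

lemma compactin_uc_finite_entourage_cover:
  fixes S :: "('a::topological_space \<Rightarrow> 'b::metric_space set) set"
  assumes S: "compactin uc_topology S"
    and "\<And>F. F \<in> S \<Longrightarrow> compact (K F) \<and> 0 < \<epsilon> F"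
  obtains \<F> where "finite \<F>" "\<F> \<subseteq> S" "S \<subseteq> (\<Union>F\<in>\<F>. uc_entourage (K F) (\<epsilon> F) `` {F})"
proof -
  have "S \<subseteq> compact_valued"
    using compactin_subset_topspace[OF S] by simp
  then have "\<exists>N. openin uc_topology N \<and> F \<in> N \<and> N \<subseteq> uc_entourage (K F) (\<epsilon> F) `` {F}"
    if "F \<in> S" for F
    using that assms(2) by (meson subsetD uc_entourage_section_neighbourhood)
  then obtain N where N: "\<And>F. F \<in> S \<Longrightarrow>
      openin uc_topology (N F) \<and> F \<in> N F \<and> N F \<subseteq> uc_entourage (K F) (\<epsilon> F) `` {F}"
    by metis
  have "\<exists>\<G>. finite \<G> \<and> \<G> \<subseteq> N ` S \<and> S \<subseteq> \<Union>\<G>"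
    by (rule compactinD[OF S]) (use N in blast)+
  then obtain \<F> where "finite \<F>" "\<F> \<subseteq> S" "S \<subseteq> \<Union>(N ` \<F>)"
    by (metis finite_subset_image)
  then show ?thesis
    using N by (intro that[of \<F>]) blast+
qed

section \<open>Two-valued minimal usco maps\<close>

text \<open>The second set is the complement of \<open>interior (closure W)\<close>. With the complement of \<open>W\<close> in
  its place the map would fail to be minimal: for a punctured neighbourhood \<open>W\<close>, the value \<open>z\<close>
  at the puncture could be dropped.\<close>

definition two_valued ::
    "'b \<Rightarrow> 'b \<Rightarrow> 'a::topological_space set \<Rightarrow> 'a \<Rightarrow> 'b::metric_space set" where
  "two_valued y z W x =
     (if x \<in> closure W then {y} else {}) \<union> (if x \<in> closure (- closure W) then {z} else {})"

lemma two_valued_eq_left: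
  assumes "x \<notin> closure (- closure W)"
  shows "two_valued y z W x = {y}"
proof -
  have "x \<in> closure W"
    using assms closure_subset[of "- closure W"] by blast
  with assms show ?thesis by (simp add: two_valued_def)
qed

lemma two_valued_eq_right:
  assumes "x \<notin> closure W"
  shows "two_valued y z W x = {z}"
proof -
  have "x \<in> closure (- closure W)"
    using assms closure_subset[of "- closure W"] by blast
  with assms show ?thesis by (simp add: two_valued_def)
qed

lemma two_valued_on_open:
  assumes "open W" "x \<in> W"
  shows "two_valued y z W x = {y}"
proof (rule two_valued_eq_left)
  have "W \<inter> - closure W = {}"
    using closure_subset[of W] by blast
  then show "x \<notin> closure (- closure W)"
    using assms open_Int_closure_eq_empty[OF assms(1)] by blast
qed

lemma two_valued_subset: "two_valued y z W x \<subseteq> {y, z}"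
  by (auto simp: two_valued_def)

lemma usco_two_valued: "usco (two_valued y z W)"
  unfolding usco_def
proof (intro conjI allI)
  show nonempty: "two_valued y z W x \<noteq> {}" for x
    using two_valued_eq_right[of x W y z] by (cases "x \<in> closure W") (auto simp: two_valued_def)
  show "compact (two_valued y z W x)" for x
    by (simp add: two_valued_def)
  show "upper_semicontinuous (two_valued y z W)"
    unfolding upper_semicontinuous_def
  proof (intro allI impI)
    fix x V
    assume V: "open V \<and> two_valued y z W x \<subseteq> V"
    then consider "y \<in> V" "z \<in> V" | "y \<in> V" "x \<notin> closure (- closure W)"
      | "z \<in> V" "x \<notin> closure W"
      using nonempty[of x] by (auto simp: two_valued_def split: if_splits)
    then show "\<exists>U. open U \<and> x \<in> U \<and> map_image (two_valued y z W) U \<subseteq> V"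
    proof cases
      case 1
      then show ?thesis
        using two_valued_subset[of y z W]
        by (intro exI[of _ UNIV]) (auto simp: map_image_def)
    next
      case 2
      then show ?thesis
        by (intro exI[of _ "- closure (- closure W)"])
          (auto simp: map_image_def two_valued_eq_left)
    next
      case 3
      then show ?thesis
        by (intro exI[of _ "- closure W"])
          (auto simp: map_image_def two_valued_eq_right)
    qed
  qed
qed

text \<open>A usco submap cannot drop a value \<open>v\<close> at a point that is a limit of points where \<open>{v}\<close> is
  the entire value: dropping it would drop it on a whole neighbourhood.\<close>

lemma usco_submap_keeps_limit_value:
  fixes F G :: "'a::topological_space \<Rightarrow> 'b::t1_space set"
  assumes G: "usco G" and sub: "\<And>x. G x \<subseteq> F x"
    and A: "\<And>x. x \<in> A \<Longrightarrow> F x = {v}" and x: "x \<in> closure A"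
  shows "v \<in> G x"
proof (rule ccontr)
  assume "v \<notin> G x"
  then have "open (- {v}) \<and> G x \<subseteq> - {v}" by blast
  then obtain U where U: "open U" "x \<in> U" "map_image G U \<subseteq> - {v}"
    using G unfolding usco_def upper_semicontinuous_def by blast
  then obtain a where "a \<in> U" "a \<in> A"
    using x open_Int_closure_eq_empty[of U A] by blast
  moreover have "G a = {v}" if "a \<in> A" for a
    using G sub[of a] A[OF that] unfolding usco_def by (metis subset_singleton_iff)
  ultimately show False
    using U(3) by (auto simp: map_image_def)
qed

lemma minimal_usco_two_valued:
  assumes W: "open W"
  shows "minimal_usco (two_valued y z W)"
  unfolding minimal_usco_def
proof (intro conjI notI)
  show "usco (two_valued y z W)" by (rule usco_two_valued)
  assume "\<exists>G. usco G \<and> map_graph G \<subset> map_graph (two_valued y z W)"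
  then obtain G where G: "usco G" and less: "map_graph G \<subset> map_graph (two_valued y z W)"
    by blast
  have sub: "G x \<subseteq> two_valued y z W x" for x
    using less by (auto simp: map_graph_def)
  have "y \<in> G x" if "x \<in> closure W" for x
    using usco_submap_keeps_limit_value[OF G sub two_valued_on_open[OF W] that] .
  moreover have "z \<in> G x" if "x \<in> closure (- closure W)" for x
    using usco_submap_keeps_limit_value[OF G sub two_valued_eq_right that] by blast
  ultimately have "two_valued y z W x \<subseteq> G x" for x
    by (simp add: two_valued_def)
  then show False
    using less by (auto simp: map_graph_def)
qed

lemma two_valued_in_D2: "open W \<Longrightarrow> two_valued y z W \<in> D2"
proof -
  assume W: "open W"
  have sub: "map_image (two_valued y z W) UNIV \<subseteq> {y, z}"
    using two_valued_subset by (fastforce simp: map_image_def)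
  then have "card (map_image (two_valued y z W) UNIV) \<le> card {y, z}"
    by (intro card_mono) simp_all
  also have "\<dots> \<le> 2"
    by (simp add: card_insert_if)
  finally show ?thesis
    using minimal_usco_two_valued[OF W] finite_subset[OF sub]
    by (simp add: D2_def MU_def)
qed

section \<open>Necessity\<close>

text \<open>Fix a point \<open>x\<close>. A constant map \<open>{b}\<close> whose value is \<open>\<epsilon>\<close>-close to \<open>F x\<close> in the Hausdorff
  distance has \<open>b\<close> in the \<open>\<epsilon>\<close>-ball around every point of \<open>F x\<close>. So it suffices to adapt \<open>\<epsilon>\<close> to
  one chosen point \<open>y F\<close> of \<open>F x\<close> and one member of the open cover containing it.\<close>

lemma compactin_uc_imp_compact_codomain:
  fixes S :: "('a::topological_space \<Rightarrow> 'b::metric_space set) set"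
  assumes S: "compactin uc_topology S" and D2: "D2 \<subseteq> S"
  shows "compact (UNIV :: 'b set)"
proof (rule compactI)
  fix \<C> :: "'b set set"
  assume \<C>: "\<forall>C\<in>\<C>. open C" "UNIV \<subseteq> \<Union>\<C>"
  fix x :: 'a
  have S_compact: "F \<in> compact_valued" if "F \<in> S" for F
    using compactin_subset_topspace[OF S] that by auto
  have "\<exists>C \<epsilon> y. C \<in> \<C> \<and> 0 < \<epsilon> \<and> y \<in> F x \<and> ball y \<epsilon> \<subseteq> C" if FS: "F \<in> S" for F
  proof -
    obtain y where "y \<in> F x"
      using S_compact[OF FS] by (auto simp: compact_valued_def nonempty_compacts_def)
    then show ?thesis
      using \<C> by (meson UNIV_I UnionE open_contains_ball subsetD)
  qed
  then obtain C \<epsilon> y where C: "\<And>F. F \<in> S \<Longrightarrow>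
      C F \<in> \<C> \<and> (0::real) < \<epsilon> F \<and> y F \<in> F x \<and> ball (y F) (\<epsilon> F) \<subseteq> C F"
    by metis
  then have "compact {x} \<and> 0 < \<epsilon> F" if "F \<in> S" for F
    using that by simp
  then obtain \<F> where \<F>: "finite \<F>" "\<F> \<subseteq> S" "S \<subseteq> (\<Union>F\<in>\<F>. uc_entourage {x} (\<epsilon> F) `` {F})"
    using compactin_uc_finite_entourage_cover[OF S, of "\<lambda>_. {x}" \<epsilon>] by blast
  have "\<exists>F\<in>\<F>. b \<in> C F" for b
  proof -
    have "two_valued b b UNIV \<in> S"
      using two_valued_in_D2[OF open_UNIV] D2 by blast
    then obtain F where F: "F \<in> \<F>" "hausdorff_dist (F x) {b} < \<epsilon> F"
      using \<F>(3) by (fastforce simp: uc_entourage_def two_valued_on_open)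
    then have "F \<in> S" using \<F>(2) by blast
    have "dist b (y F) \<le> hausdorff_dist {b} (F x)"
      using C[OF \<open>F \<in> S\<close>] S_compact[OF \<open>F \<in> S\<close>]
      by (simp add: dist_le_hausdorff_dist_singleton compact_valued_nonempty_compacts)
    then have "b \<in> ball (y F) (\<epsilon> F)"
      using F(2) by (simp add: hausdorff_dist_commute dist_commute)
    then show ?thesis
      using C[OF \<open>F \<in> S\<close>] F(1) by blast
  qed
  then show "\<exists>\<C>'\<subseteq>\<C>. finite \<C>' \<and> UNIV \<subseteq> \<Union>\<C>'"
    using C \<F>(1,2) by (intro exI[of _ "C ` \<F>"]) blast
qed

text \<open>A point \<open>p\<close> of \<open>K\<close> is labelled by the members of a finite entourage cover that contain a
  two-valued map with value \<open>{y}\<close> at \<open>p\<close>. Two-valued maps in the same member take the value \<open>{y}\<close>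
  at the same points of \<open>K\<close>, so the labels separate whatever the two-valued maps separate.\<close>

lemma compactin_uc_imp_finite_compacts:
  fixes S :: "('a::t2_space \<Rightarrow> 'b::metric_space set) set" and y z :: 'b and K :: "'a set"
  assumes S: "compactin uc_topology S" and D2: "D2 \<subseteq> S" and "y \<noteq> z" and K: "compact K"
  shows "finite K"
proof -
  have S_compact: "F \<in> compact_valued" if "F \<in> S" for F
    using compactin_subset_topspace[OF S] that by auto
  have two_S: "two_valued y z W \<in> S" if "open W" for W
    using two_valued_in_D2[OF that] D2 by blast
  have "compact K \<and> 0 < dist y z / 2"
    using K \<open>y \<noteq> z\<close> by simp
  then obtain \<F> where \<F>: "finite \<F>" "\<F> \<subseteq> S"
    "S \<subseteq> (\<Union>F\<in>\<F>. uc_entourage K (dist y z / 2) `` {F})"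
    using compactin_uc_finite_entourage_cover[OF S, of "\<lambda>_. K" "\<lambda>_. dist y z / 2"] by blast
  define label where "label p = {F \<in> \<F>. \<exists>W. open W \<and> two_valued y z W p = {y} \<and>
      (F, two_valued y z W) \<in> uc_entourage K (dist y z / 2)}" for p
  have "\<exists>F. F \<in> label p \<and> F \<notin> label q" if pq: "p \<in> K" "q \<in> K" "p \<noteq> q" for p q
  proof -
    obtain W V where W: "open W" "open V" "p \<in> W" "q \<in> V" "W \<inter> V = {}"
      using hausdorff[OF \<open>p \<noteq> q\<close>] by blast
    then have "q \<notin> closure W"
      using open_Int_closure_eq_empty[of V W] by blast
    then have z: "two_valued y z W q = {z}"
      by (rule two_valued_eq_right)
    obtain F where F: "F \<in> \<F>" "(F, two_valued y z W) \<in> uc_entourage K (dist y z / 2)"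
      using two_S[OF W(1)] \<F>(3) by blast
    have "F \<notin> label q"
    proof
      assume "F \<in> label q"
      then obtain W' where y: "two_valued y z W' q = {y}"
        and W': "(F, two_valued y z W') \<in> uc_entourage K (dist y z / 2)"
        by (auto simp: label_def)
      have "F \<in> compact_valued"
        using F(1) \<F>(2) S_compact by blast
      then have "hausdorff_dist {y} {z} \<le> hausdorff_dist {y} (F q) + hausdorff_dist (F q) {z}"
        by (intro hausdorff_dist_triangle)
          (simp_all add: singleton_nonempty_compacts compact_valued_nonempty_compacts)
      also have "\<dots> < dist y z"
        using F(2) W' pq(2) y z hausdorff_dist_commute[of "{y}" "F q"]
        by (fastforce simp: uc_entourage_def)
      finally show False
        by (simp add: hausdorff_dist_singletons)
    qed
    moreover have "F \<in> label p"
      using F W(1) two_valued_on_open[OF W(1,3), of y z] by (auto simp: label_def)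
    ultimately show ?thesis by blast
  qed
  then have "inj_on label K"
    by (metis inj_onI)
  moreover have "label ` K \<subseteq> Pow \<F>"
    by (auto simp: label_def)
  ultimately show ?thesis
    using \<F>(1) inj_on_finite by blast
qed

lemma locally_compact_finite_compacts_imp_discrete:
  assumes "locally_compact_space (euclidean :: 'a::t2_space topology)"
    and "\<And>K :: 'a set. compact K \<Longrightarrow> finite K"
  shows "(euclidean :: 'a topology) = discrete_topology UNIV"
proof -
  have "open {x}" for x :: 'a
  proof -
    obtain U K where U: "open U" "compact K" "x \<in> U" "U \<subseteq> K"
      using assms(1) unfolding locally_compact_space_def by simp metis
    then have "closed (U - {x})"
      using assms(2) by (intro finite_imp_closed) (meson finite_Diff finite_subset)
    then have "open (U - (U - {x}))"
      using U(1) by blast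
    moreover have "U - (U - {x}) = {x}" using U(3) by blast
    ultimately show ?thesis by simp
  qed
  then show ?thesis
    by (metis discrete_topology_unique open_openin topspace_euclidean)
qed

section \<open>Sufficiency\<close>

text \<open>Without continuity constraints, any selection of a usco map is a usco submap.\<close>

lemma minimal_usco_discrete_iff:
  fixes F :: "'a::topological_space \<Rightarrow> 'b::topological_space set"
  assumes "(euclidean :: 'a topology) = discrete_topology UNIV"
  shows "minimal_usco F \<longleftrightarrow> (\<exists>f. F = (\<lambda>x. {f x}))"
proof
  have opn: "open A" for A :: "'a set"
    by (simp add: open_openin assms)
  have usco: "usco (\<lambda>x. {f x})" for f :: "'a \<Rightarrow> 'b"
    unfolding usco_def upper_semicontinuous_def
  proof (intro conjI allI impI)
    fix x :: 'a and V :: "'b set"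
    assume "open V \<and> {f x} \<subseteq> V"
    then show "\<exists>U. open U \<and> x \<in> U \<and> map_image (\<lambda>x. {f x}) U \<subseteq> V"
      by (intro exI[of _ "{x}"]) (simp add: map_image_def opn)
  qed simp_all
  show "\<exists>f. F = (\<lambda>x. {f x})" if F: "minimal_usco F"
  proof -
    have "\<forall>x. \<exists>y. y \<in> F x"
      using F by (auto simp: minimal_usco_def usco_def)
    then obtain f where f: "\<And>x. f x \<in> F x" by metis
    then have "map_graph (\<lambda>x. {f x}) \<subseteq> map_graph F"
      by (auto simp: map_graph_def)
    then have "map_graph (\<lambda>x. {f x}) = map_graph F"
      using F usco[of f] by (auto simp: minimal_usco_def)
    then have "F x = {f x}" for x
      by (auto simp: map_graph_def set_eq_iff)
    then show ?thesis by blast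
  qed
  show "minimal_usco F" if single: "\<exists>f. F = (\<lambda>x. {f x})"
  proof -
    obtain f where F: "F = (\<lambda>x. {f x})" using single by blast
    have "map_graph G = map_graph F" if G: "usco G" "map_graph G \<subseteq> map_graph F" for G
    proof -
      have "G x \<noteq> {}" "G x \<subseteq> {f x}" for x
        using G by (auto simp: usco_def map_graph_def F)
      then have "G x = F x" for x
        unfolding F by (simp add: subset_singleton_iff)
      then show ?thesis by (simp add: map_graph_def)
    qed
    then show ?thesis
      unfolding minimal_usco_def using usco F by blast
  qed
qed

lemma continuous_map_singletons_uc:
  assumes "(euclidean :: 'a::topological_space topology) = discrete_topology UNIV"
  shows "continuous_map (euclidean :: ('a \<Rightarrow> 'b::metric_space) topology) uc_topology
           (\<lambda>f x. {f x})"
  unfolding continuous_map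
proof (intro conjI allI impI)
  have cv: "(\<lambda>x. {f x}) \<in> compact_valued" for f :: "'a \<Rightarrow> 'b"
    by (simp add: compact_valued_def singleton_nonempty_compacts)
  then show "(\<lambda>f x. {f x}) ` topspace (euclidean :: ('a \<Rightarrow> 'b) topology) \<subseteq> topspace uc_topology"
    by auto
  fix \<U> :: "('a \<Rightarrow> 'b set) set"
  assume \<U>: "openin uc_topology \<U>"
  have "\<exists>T. open T \<and> f \<in> T \<and> T \<subseteq> {f. (\<lambda>x. {f x}) \<in> \<U>}" if f: "(\<lambda>x. {f x}) \<in> \<U>" for f
  proof -
    obtain K \<epsilon> where K: "compact K" "0 < \<epsilon>" "uc_entourage K \<epsilon> `` {\<lambda>x. {f x}} \<subseteq> \<U>"
      using bspec[OF conjunct2[OF \<U>[unfolded openin_uc_topology]] f] by metis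
    have "finite K"
      using K(1) assms compactin_discrete_topology[of UNIV K]
      by (metis compactin_euclidean_iff)
    then have "open (\<Inter>x\<in>K. {g. dist (f x) (g x) < \<epsilon>})"
      by (intro open_INT ballI open_Collect_less continuous_intros
          continuous_on_product_coordinates)
    moreover have "(\<Inter>x\<in>K. {g. dist (f x) (g x) < \<epsilon>}) \<subseteq> {f. (\<lambda>x. {f x}) \<in> \<U>}"
      using K(3) cv by (auto simp: uc_entourage_def hausdorff_dist_singletons subset_iff)
    ultimately show ?thesis
      using K(2) by (intro exI[of _ "\<Inter>x\<in>K. {g. dist (f x) (g x) < \<epsilon>}"]) simp
  qed
  then have "open {f. (\<lambda>x. {f x}) \<in> \<U>}"
    by (subst open_subopen) blast
  then show "openin euclidean {f \<in> topspace (euclidean :: ('a \<Rightarrow> 'b) topology). (\<lambda>x. {f x}) \<in> \<U>}"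
    by simp
qed

lemma compact_UNIV_fun:
  assumes "compact (UNIV :: 'b::topological_space set)"
  shows "compact (UNIV :: ('a \<Rightarrow> 'b) set)"
proof -
  have "compact_space (euclidean :: 'b topology)"
    using assms by (simp add: compact_space_def)
  then have "compact_space (product_topology (\<lambda>_. euclidean :: 'b topology) (UNIV :: 'a set))"
    by (simp add: compact_space_product_topology)
  then show ?thesis
    by (simp add: euclidean_product_topology compact_space_def)
qed

lemma finite_card_le_2_iff:
  "finite A \<and> card A \<le> 2 \<longleftrightarrow> (\<forall>a\<in>A. \<forall>b\<in>A. \<forall>c\<in>A. a = b \<or> a = c \<or> b = c)"
proof
  assume A: "finite A \<and> card A \<le> 2"
  show "\<forall>a\<in>A. \<forall>b\<in>A. \<forall>c\<in>A. a = b \<or> a = c \<or> b = c"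
  proof (intro ballI, rule ccontr)
    fix a b c assume "a \<in> A" "b \<in> A" "c \<in> A" "\<not> (a = b \<or> a = c \<or> b = c)"
    then have "{a, b, c} \<subseteq> A" "card {a, b, c} = 3" by auto
    then show False using A card_mono[of A "{a, b, c}"] by simp
  qed
next
  assume A: "\<forall>a\<in>A. \<forall>b\<in>A. \<forall>c\<in>A. a = b \<or> a = c \<or> b = c"
  show "finite A \<and> card A \<le> 2"
  proof (rule ccontr)
    assume "\<not> (finite A \<and> card A \<le> 2)"
    then have "\<exists>B\<subseteq>A. card B = 3"
      using infinite_arbitrarily_large[of A 3] obtain_subset_with_card_n[of 3 A]
      by (metis Suc_leI eval_nat_numeral(3) not_le)
    then obtain a b c where "a \<in> A" "b \<in> A" "c \<in> A" "a \<noteq> b" "a \<noteq> c" "b \<noteq> c"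
      by (auto simp: card_3_iff)
    with A show False by blast
  qed
qed

lemma closed_at_most_two_values:
  "closed {f :: 'a \<Rightarrow> 'b::t2_space. finite (range f) \<and> card (range f) \<le> 2}"
proof -
  have "{f :: 'a \<Rightarrow> 'b. finite (range f) \<and> card (range f) \<le> 2} =
      (\<Inter>a b c. {f. f a = f b \<or> f a = f c \<or> f b = f c})"
    unfolding finite_card_le_2_iff by auto
  moreover have "closed {f :: 'a \<Rightarrow> 'b. f a = f b \<or> f a = f c \<or> f b = f c}" for a b c
    by (intro closed_Collect_disj closed_Collect_eq continuous_on_product_coordinates)
  ultimately show ?thesis by (simp add: closed_INT)
qed

text \<open>Both sets are images of closed, hence compact, subsets of the product \<open>Y\<^sup>X\<close> under the
  continuous map \<open>f \<mapsto> (x \<mapsto> {f x})\<close>.\<close>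

lemma discrete_compact_imp_compactin_uc:
  assumes discrete: "(euclidean :: 'a::topological_space topology) = discrete_topology UNIV"
    and "compact (UNIV :: 'b::metric_space set)"
  shows "compactin uc_topology (MU :: ('a \<Rightarrow> 'b set) set)"
    and "compactin uc_topology (D2 :: ('a \<Rightarrow> 'b set) set)"
proof -
  have image: "compactin uc_topology ((\<lambda>f x. {f x}) ` A)" if "closed A" for A :: "('a \<Rightarrow> 'b) set"
    using image_compactin[OF _ continuous_map_singletons_uc[OF discrete], of A]
      compact_Int_closed[OF compact_UNIV_fun[OF assms(2)] that]
    by (simp add: compactin_euclidean_iff)
  have MU: "MU = (\<lambda>f x. {f x}) ` (UNIV :: ('a \<Rightarrow> 'b) set)"
    unfolding MU_def minimal_usco_discrete_iff[OF discrete] by blast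
  then show "compactin uc_topology (MU :: ('a \<Rightarrow> 'b set) set)"
    using image[OF closed_UNIV] by simp
  have range: "map_image (\<lambda>x. {f x}) UNIV = range f" for f :: "'a \<Rightarrow> 'b"
    by (auto simp: map_image_def)
  have "D2 = (\<lambda>f x. {f x}) ` {f :: 'a \<Rightarrow> 'b. finite (range f) \<and> card (range f) \<le> 2}"
    unfolding D2_def MU by (auto simp: range)
  then show "compactin uc_topology (D2 :: ('a \<Rightarrow> 'b set) set)"
    using image[OF closed_at_most_two_values] by simp
qed

section \<open>The equivalence\<close>

lemma D2_subset_MU: "D2 \<subseteq> MU"
  by (auto simp: D2_def)

lemma compact_MU_space_iff:
  "compact_space (MU_space :: ('a::topological_space \<Rightarrow> 'b::metric_space set) topology) \<longleftrightarrow>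
     compactin uc_topology (MU :: ('a \<Rightarrow> 'b set) set)"
  by (simp add: MU_space_def compactin_subspace MU_subset_compact_valued)

lemma compact_D2_space_iff:
  "compact_space (D2_space :: ('a::topological_space \<Rightarrow> 'b::metric_space set) topology) \<longleftrightarrow>
     compactin uc_topology (D2 :: ('a \<Rightarrow> 'b set) set)"
  by (simp add: D2_space_def MU_space_def subtopology_subtopology Int_absorb1 D2_subset_MU
      compactin_subspace subset_trans[OF D2_subset_MU MU_subset_compact_valued])

theorem theorem3p7:
  assumes "locally_compact_space (euclidean :: 'a::t2_space topology)"
    and "\<exists>y z :: 'b::metric_space. y \<noteq> z"
  shows "(compact_space (MU_space :: ('a::t2_space \<Rightarrow> 'b::metric_space set) topology) \<longleftrightarrow>
            compact_space (D2_space :: ('a::t2_space \<Rightarrow> 'b::metric_space set) topology)) \<and>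
         (compact_space (D2_space :: ('a::t2_space \<Rightarrow> 'b::metric_space set) topology) \<longleftrightarrow>
            compact (UNIV :: 'b::metric_space set) \<and>
            (euclidean :: 'a::t2_space topology) = discrete_topology UNIV)"
proof -
  let ?C = "compact (UNIV :: 'b set) \<and> (euclidean :: 'a topology) = discrete_topology UNIV"
  obtain y z :: 'b where "y \<noteq> z" using assms(2) by blast
  have necessary: ?C
    if "compactin uc_topology S" "D2 \<subseteq> S" for S :: "('a \<Rightarrow> 'b set) set"
    using compactin_uc_imp_compact_codomain[OF that]
      locally_compact_finite_compacts_imp_discrete[OF assms(1)]
      compactin_uc_imp_finite_compacts[OF that \<open>y \<noteq> z\<close>] by blast
  have "compactin uc_topology (MU :: ('a \<Rightarrow> 'b set) set) \<longleftrightarrow> ?C"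
    using necessary[OF _ D2_subset_MU] discrete_compact_imp_compactin_uc(1) by blast
  moreover have "compactin uc_topology (D2 :: ('a \<Rightarrow> 'b set) set) \<longleftrightarrow> ?C"
    using necessary[OF _ order_refl] discrete_compact_imp_compactin_uc(2) by blast
  ultimately show ?thesis
    unfolding compact_MU_space_iff compact_D2_space_iff by blast
qed

end
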